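(* Let $0<\alpha<1$, $0<q<1$, $\rho<1$, $p=q^{\rho}$ and $r=q^{1-\rho}$. For $n\in\mathbb{N}_0$ let $$\tilde{\phi}_{\alpha,pq}(n)=\prod_{k=1}^{n}\frac{p^{\alpha+k-1}-q^{\alpha+k-1}}{p^{k}-q^{k}},\qquad C_r=\frac{(r^\alpha;r)_\infty}{(r;r)_\infty}.$$ Then $\tilde{\phi}_{\alpha,pq}(n)\sim C_r\,q^{n\rho(\alpha-1)}$ as $n\to\infty$. Consequently: (i) if $\rho<0$ (equivalently $p>1$), then $\tilde{\phi}_{\alpha,pq}(n)\sim C_r e^{-Dn}$, where $D>0$ is defined by $e^{-D}=q^{\rho(\alpha-1)}=p^{\alpha-1}$, so the kernel decays exponentially; (ii) if $\rho=0$ (equivalently $p=1$), then the kernel approaches a finite constant; (iii) if $0<\rho<1$ (equivalently $q<p<1$), then the kernel grows exponentially.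
   Context: For $|r|<1$ and $b\in\mathbb{C}$, $(b;r)_\infty=\prod_{k=0}^{\infty}(1-br^k)$ is the infinite $q$-Pochhammer symbol with base $r$. The sequence $\tilde{\phi}_{\alpha,pq}(n)=\binom{n+\alpha-1}{n}_{pq}$ is the $(p,q)$-deformed memory kernel ($(p,q)$-binomial coefficient). The notation $u_n\sim v_n$ means $u_n/v_n\to1$ as $n\to\infty$. *)

theory Defs
  imports "HOL-Analysis.Analysis" "HOL-Library.Landau_Symbols"
begin

text \<open>The infinite q-Pochhammer symbol \<open>(b; r)\<^sub>\<infinity>\<close>, meaningful for \<open>norm r < 1\<close>.\<close>

definition qpochhammer_inf :: "'a \<Rightarrow> 'a \<Rightarrow> 'a::real_normed_field" where
  "qpochhammer_inf b r = (\<Prod>k. 1 - b * r ^ k)"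

text \<open>The \<open>(p,q)\<close>-binomial coefficient of \<open>n + \<alpha> - 1\<close> over \<open>n\<close>, with the common factors
  \<open>1 / (p - q)\<close> of the \<open>(p,q)\<close>-numbers cancelled.\<close>

definition pq_kernel :: "real \<Rightarrow> real \<Rightarrow> real \<Rightarrow> nat \<Rightarrow> real" where
  "pq_kernel \<alpha> p q n =
     (\<Prod>k=1..n. (p powr (\<alpha> + real k - 1) - q powr (\<alpha> + real k - 1)) / (p ^ k - q ^ k))"

definition pq_kernel_const :: "real \<Rightarrow> real \<Rightarrow> real" where
  "pq_kernel_const \<alpha> r = qpochhammer_inf (r powr \<alpha>) r / qpochhammer_inf r r"

text \<open>Exponential behaviour is understood as exact order: bounded above and below, up to positive
  constant factors, by an exponential.\<close>

definition decays_exponentially :: "(nat \<Rightarrow> real) \<Rightarrow> bool" where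
  "decays_exponentially f \<longleftrightarrow> (\<exists>c>0. f \<in> \<Theta>(\<lambda>n. exp (- c * real n)))"

definition grows_exponentially :: "(nat \<Rightarrow> real) \<Rightarrow> bool" where
  "grows_exponentially f \<longleftrightarrow> (\<exists>c>0. f \<in> \<Theta>(\<lambda>n. exp (c * real n)))"

end

theory Submission
  imports Defs
begin

text \<open>
  Put \<open>r = q / p\<close>. Taking the powers of \<open>p\<close> out of the
  \<open>k\<close>-th factor of the kernel leaves \<^term>\<open>p powr (\<alpha> - 1)\<close>
  times \<^term>\<open>(1 - r powr \<alpha> * r ^ (k - 1)) / (1 - r * r ^ (k - 1))\<close>, so
  that the kernel is exactly the geometric sequence \<^term>\<open>(p powr (\<alpha> - 1)) ^
  n\<close> times the quotient of the \<open>n\<close>-th partial products of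
  \<^term>\<open>qpochhammer_inf (r powr \<alpha>) r\<close> and \<^term>\<open>qpochhammer_inf
  r r\<close> (\<open>pq_kernel_eq\<close>). Since \<open>\<rho> < 1\<close> makes \<open>r = q
  powr (1 - \<rho>)\<close> less than 1, both products converge to positive limits
  (\<open>qpochhammer_inf_has_prod\<close>, \<open>qpochhammer_inf_pos\<close>); hence the
  quotient tends to the constant \<^term>\<open>pq_kernel_const \<alpha> r\<close>, which is
  positive. The exponential behaviour is therefore that of \<^term>\<open>(p powr (\<alpha> -
  1)) ^ n = exp (c * real n)\<close> with \<^term>\<open>c = \<rho> * (\<alpha> - 1) * ln
  q\<close>, and as \<open>\<alpha> < 1\<close> and \<open>ln q < 0\<close>, the rate
  \<open>c\<close> has the sign of \<open>\<rho>\<close>.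
\<close>

lemma qpochhammer_inf_has_prod:
  fixes b r :: "'a :: {real_normed_field, banach}"
  assumes "norm r < 1"
  shows "(\<lambda>k. 1 - b * r ^ k) has_prod qpochhammer_inf b r"
proof -
  have "summable (\<lambda>k. norm ((1 - b * r ^ k) - 1))"
    using assms by (auto simp: norm_mult norm_power intro!: summable_mult summable_geometric)
  then have "convergent_prod (\<lambda>k. 1 - b * r ^ k)"
    by (intro abs_convergent_prod_imp_convergent_prod summable_imp_abs_convergent_prod)
  then show ?thesis
    unfolding qpochhammer_inf_def by (rule convergent_prod_has_prod)
qed

lemma qpochhammer_inf_pos:
  fixes b r :: real
  assumes "0 \<le> r" "r < 1" "b < 1"
  shows "qpochhammer_inf b r > 0"
proof (rule has_prod_pos)
  show "(\<lambda>k. 1 - b * r ^ k) has_prod qpochhammer_inf b r"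
    using assms by (intro qpochhammer_inf_has_prod) auto
  show "1 - b * r ^ k > 0" for k
  proof (cases "b \<le> 0")
    case True
    then have "b * r ^ k \<le> 0"
      using assms by (intro mult_nonpos_nonneg) auto
    then show ?thesis by linarith
  next
    case False
    then have "b * r ^ k \<le> b * 1"
      using assms by (intro mult_left_mono power_le_one) auto
    then show ?thesis using assms by linarith
  qed
qed

lemma pq_kernel_const_pos:
  assumes "0 < r" "r < 1" "0 < \<alpha>"
  shows "pq_kernel_const \<alpha> r > 0"
  using assms powr_less_mono2[of \<alpha> r 1]
  by (auto simp: pq_kernel_const_def intro!: divide_pos_pos qpochhammer_inf_pos)

text \<open>
  The index shift from \<open>k = 1, \<dots>, n\<close> to \<open>k < n\<close> matches the kernel with the partial products of
  the Pochhammer symbols: \<open>r powr (\<alpha> + k - 1)\<close> turns into \<open>r powr \<alpha> * r ^ k\<close>.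
\<close>
lemma pq_kernel_eq:
  assumes "0 < p" "0 < q"
  defines "r \<equiv> q / p"
  shows "pq_kernel \<alpha> p q n =
    (\<Prod>k<n. 1 - r powr \<alpha> * r ^ k) / (\<Prod>k<n. 1 - r * r ^ k) * (p powr (\<alpha> - 1)) ^ n"
proof -
  have q: "q = p * r" and r: "0 < r" using assms by (auto simp: r_def)
  have factor: "(p powr (\<alpha> + real (Suc k) - 1) - q powr (\<alpha> + real (Suc k) - 1))
      / (p ^ Suc k - q ^ Suc k)
      = p powr (\<alpha> - 1) * ((1 - r powr \<alpha> * r ^ k) / (1 - r * r ^ k))" for k
  proof -
    have pk: "p powr (\<alpha> + real (Suc k) - 1) = p powr (\<alpha> - 1) * p ^ Suc k"
    proof -
      have "\<alpha> + real (Suc k) - 1 = (\<alpha> - 1) + real (Suc k)" by simp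
      then show ?thesis using assms by (simp only: powr_add powr_realpow)
    qed
    have rk: "r powr (\<alpha> + real (Suc k) - 1) = r powr \<alpha> * r ^ k"
      using r by (simp add: powr_add powr_realpow)
    have "p powr (\<alpha> + real (Suc k) - 1) - q powr (\<alpha> + real (Suc k) - 1)
        = p ^ Suc k * (p powr (\<alpha> - 1) * (1 - r powr \<alpha> * r ^ k))"
      using assms(1) r unfolding q powr_mult pk rk by (simp add: powr_mult pk rk algebra_simps)
    moreover have "p ^ Suc k - q ^ Suc k = p ^ Suc k * (1 - r * r ^ k)"
      unfolding q by (simp add: power_mult_distrib algebra_simps)
    moreover have "p ^ Suc k \<noteq> 0" using assms by simp
    ultimately show ?thesis
      by (simp only: mult_divide_mult_cancel_left times_divide_eq_right not_False_eq_True)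
  qed
  have "pq_kernel \<alpha> p q n = (\<Prod>k<n. (p powr (\<alpha> + real (Suc k) - 1) - q powr (\<alpha> + real (Suc k) - 1))
      / (p ^ Suc k - q ^ Suc k))"
    unfolding pq_kernel_def by (simp add: prod.atLeast1_atMost_eq)
  then show ?thesis
    unfolding factor by (simp add: prod.distrib prod_dividef)
qed

text \<open>
  In this form the three regimes \<open>p > 1\<close>, \<open>p = 1\<close>, \<open>p < 1\<close> differ only in the base
  \<^term>\<open>p powr (\<alpha> - 1)\<close> of the geometric factor.
\<close>
lemma pq_kernel_asymp_equiv:
  assumes "0 < q" "q < p" "0 < \<alpha>"
  shows "pq_kernel \<alpha> p q \<sim>[sequentially]
    (\<lambda>n. pq_kernel_const \<alpha> (q / p) * (p powr (\<alpha> - 1)) ^ n)"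
proof -
  define r where "r = q / p"
  have r: "0 < r" "r < 1" using assms by (auto simp: r_def)
  have lim: "(\<lambda>n. \<Prod>k<n. 1 - b * r ^ k) \<longlonglongrightarrow> qpochhammer_inf b r" for b
    using r by (intro has_prod_imp_tendsto' qpochhammer_inf_has_prod) auto
  have "qpochhammer_inf r r \<noteq> 0"
    using qpochhammer_inf_pos[of r r] r by auto
  then have "(\<lambda>n. (\<Prod>k<n. 1 - r powr \<alpha> * r ^ k) / (\<Prod>k<n. 1 - r * r ^ k))
      \<longlonglongrightarrow> pq_kernel_const \<alpha> r"
    unfolding pq_kernel_const_def by (intro tendsto_divide lim)
  then have "(\<lambda>n. (\<Prod>k<n. 1 - r powr \<alpha> * r ^ k) / (\<Prod>k<n. 1 - r * r ^ k))
      \<sim>[sequentially] (\<lambda>_. pq_kernel_const \<alpha> r)"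
    using pq_kernel_const_pos[OF r assms(3)] by (intro tendsto_imp_asymp_equiv_const) auto
  then have "(\<lambda>n. (\<Prod>k<n. 1 - r powr \<alpha> * r ^ k) / (\<Prod>k<n. 1 - r * r ^ k) * (p powr (\<alpha> - 1)) ^ n)
      \<sim>[sequentially] (\<lambda>n. pq_kernel_const \<alpha> r * (p powr (\<alpha> - 1)) ^ n)"
    by (intro asymp_equiv_mult asymp_equiv_refl)
  moreover have "pq_kernel \<alpha> p q =
      (\<lambda>n. (\<Prod>k<n. 1 - r powr \<alpha> * r ^ k) / (\<Prod>k<n. 1 - r * r ^ k) * (p powr (\<alpha> - 1)) ^ n)"
    using assms pq_kernel_eq[of p q \<alpha>] unfolding r_def by auto
  ultimately show ?thesis unfolding r_def by simp
qed

theorem mainTheorem3: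
  fixes \<alpha> q \<rho> p r :: real
  assumes "0 < \<alpha>" and "\<alpha> < 1" and "0 < q" and "q < 1" and "\<rho> < 1"
    and "p = q powr \<rho>" and "r = q powr (1 - \<rho>)"
  shows "pq_kernel \<alpha> p q \<sim>[sequentially]
           (\<lambda>n. pq_kernel_const \<alpha> r * q powr (real n * \<rho> * (\<alpha> - 1)))
    \<and> (\<rho> < 0 \<longleftrightarrow> p > 1)
    \<and> (\<rho> < 0 \<longrightarrow>
         (\<exists>D>0. exp (- D) = q powr (\<rho> * (\<alpha> - 1)) \<and> exp (- D) = p powr (\<alpha> - 1)
            \<and> pq_kernel \<alpha> p q \<sim>[sequentially] (\<lambda>n. pq_kernel_const \<alpha> r * exp (- D * real n)))
         \<and> decays_exponentially (pq_kernel \<alpha> p q))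
    \<and> (\<rho> = 0 \<longleftrightarrow> p = 1)
    \<and> (\<rho> = 0 \<longrightarrow> pq_kernel \<alpha> p q \<longlonglongrightarrow> pq_kernel_const \<alpha> r)
    \<and> (0 < \<rho> \<and> \<rho> < 1 \<longleftrightarrow> q < p \<and> p < 1)
    \<and> (0 < \<rho> \<and> \<rho> < 1 \<longrightarrow> grows_exponentially (pq_kernel \<alpha> p q))"
proof -
  define c where "c = \<rho> * (\<alpha> - 1) * ln q"
  have lnq: "ln q < 0" using assms by simp
  have p0: "0 < p" using assms by simp
  have p_less: "p < 1 \<longleftrightarrow> 0 < \<rho>" and p_gt: "1 < p \<longleftrightarrow> \<rho> < 0"
    using lnq assms by (auto simp: powr_def mult_less_0_iff zero_less_mult_iff)
  have p_one: "\<rho> = 0 \<longleftrightarrow> p = 1" using p_less p_gt by linarith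
  have "q powr 1 < q powr \<rho>"
    using assms by (intro powr_less_mono') auto
  then have qp: "q < p" using assms by simp
  have r_eq: "r = q / p" using assms by (simp add: powr_diff)
  define C where "C = pq_kernel_const \<alpha> r"
  have C: "C > 0" unfolding C_def
    using assms(1,3) p0 qp by (intro pq_kernel_const_pos) (auto simp: r_eq)
  have pc: "p powr (\<alpha> - 1) = exp c" and qc: "q powr (\<rho> * (\<alpha> - 1)) = exp c"
    using assms by (simp_all add: c_def powr_def algebra_simps)
  have qcn: "q powr (real n * \<rho> * (\<alpha> - 1)) = exp (c * real n)" for n
    using assms by (simp add: c_def powr_def algebra_simps)
  have asymp: "pq_kernel \<alpha> p q \<sim>[sequentially] (\<lambda>n. C * exp (c * real n))"
    using pq_kernel_asymp_equiv[OF assms(3) qp assms(1)]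
    unfolding C_def r_eq pc by (simp add: exp_of_nat2_mult)
  then have theta: "pq_kernel \<alpha> p q \<in> \<Theta>(\<lambda>n. exp (c * real n))"
    using asymp_equiv_imp_bigtheta[OF asymp] C by simp
  \<comment> \<open>Both \<open>\<alpha> - 1\<close> and \<open>ln q\<close> are negative, so the exponential rate has the sign of \<open>\<rho>\<close>.\<close>
  have factor_pos: "0 < (\<alpha> - 1) * ln q"
    using assms(2) lnq by (intro mult_neg_neg) auto
  have c_sign: "\<rho> < 0 \<longleftrightarrow> c < 0" "0 < \<rho> \<longleftrightarrow> 0 < c"
    using factor_pos unfolding c_def mult.assoc
    by (metis mult_less_cancel_right_pos mult_zero_left)+
  have decay: "(\<exists>D>0. exp (- D) = q powr (\<rho> * (\<alpha> - 1)) \<and> exp (- D) = p powr (\<alpha> - 1)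
          \<and> pq_kernel \<alpha> p q \<sim>[sequentially] (\<lambda>n. C * exp (- D * real n)))
        \<and> decays_exponentially (pq_kernel \<alpha> p q)" if "\<rho> < 0"
  proof
    show "\<exists>D>0. exp (- D) = q powr (\<rho> * (\<alpha> - 1)) \<and> exp (- D) = p powr (\<alpha> - 1)
          \<and> pq_kernel \<alpha> p q \<sim>[sequentially] (\<lambda>n. C * exp (- D * real n))"
      using c_sign that asymp pc qc by (intro exI[of _ "- c"]) simp
    show "decays_exponentially (pq_kernel \<alpha> p q)"
      unfolding decays_exponentially_def using c_sign that theta by (intro exI[of _ "- c"]) simp
  qed
  have const: "pq_kernel \<alpha> p q \<longlonglongrightarrow> C" if "\<rho> = 0"
    using asymp that by (intro asymp_equivD_const) (simp add: c_def)
  have growth: "grows_exponentially (pq_kernel \<alpha> p q)" if "0 < \<rho>"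
    unfolding grows_exponentially_def using c_sign that theta by blast
  show ?thesis
    unfolding C_def[symmetric] qcn
    using asymp p_gt p_one p_less qp assms(5) decay const growth by blast
qed

end
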